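(* Let $\mathcal{M} = (G, \mathbf{V}, P)$ be a causal model satisfying the causal Markov condition. Let $\mathbf{X}, \mathbf{Z} \subseteq \mathbf{V}$ be two disjoint sets and $Y \in \mathbf{V}$, such that $Y -^{s}_{\le 2} \mathbf{X}$ and $Y -^{s}_{\le 2} \mathbf{Z}$, and such that no node $X \in \mathbf{X}$ is adjacent in $G$ to any node $Z \in \mathbf{Z}$. Then the following orientation rule is sound, i.e. both implications hold: (i) If for each pair $X \in \mathbf{X}$, $Z \in \mathbf{Z}$ it holds that $X$ is dependent on $Z$ (in $P$) given every subset of $\mathbf{V} \setminus \{X, Z\}$ that contains $\{Y\} \cup (\mathbf{X} \setminus \{X\}) \cup (\mathbf{Z} \setminus \{Z\})$, then $\mathbf{X} \to Y \leftarrow \mathbf{Z}$ in $G$, i.e. every node of $\mathbf{X} \cup \mathbf{Z}$ is a parent of $Y$ in $G$. (ii) Otherwise (the premise of (i) does not hold), if for each pair $X \in \mathbf{X}$, $Z \in \mathbf{Z}$ it holds that $X$ is dependent on $Z$ (in $P$) given every subset of $\mathbf{V} \setminus \{X, Z\}$ that contains $(\mathbf{X} \setminus \{X\}) \cup (\mathbf{Z} \setminus \{Z\})$ but does not contain $Y$, then $Y$ is a non-collider on at least one path $\langle X, Y, Z \rangle$ in $G$ with $X \in \mathbf{X}$ and $Z \in \mathbf{Z}$.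
   Context: A causal model $\mathcal{M} = (G, \mathbf{V}, P)$ consists of a finite set $\mathbf{V}$ of random variables with joint distribution $P$ and a directed acyclic graph (DAG) $G$ whose nodes are the variables in $\mathbf{V}$. For sets $\mathbf{A},\mathbf{B},\mathbf{C}\subseteq \mathbf{V}$, $\mathbf{A} \perp\!\!\!\perp_P \mathbf{B} \mid \mathbf{C}$ denotes conditional independence in $P$, and $\not\perp\!\!\!\perp_P$ its negation (dependence). The causal Markov condition holds if every $d$-separation in $G$ implies the corresponding conditional independence in $P$. A path is a sequence of distinct nodes, consecutive ones being adjacent in $G$ (joined by an edge in either direction). $Y$ is a collider on a path $\langle X, Y, Z\rangle$ if $X \to Y \leftarrow Z$ in $G$, and a non-collider on it otherwise. Associations (with respect to $P$): - For distinct $X, Y \in \mathbf{V}$, $X$ is 1-associated to $Y$ if $X \not\perp\!\!\!\perp_P Y \mid \mathbf{S}$ for all $\mathbf{S} \subseteq \mathbf{V} \setminus \{X, Y\}$. - For distinct $X, Y_1, Y_2 \in \mathbf{V}$, $X$ is 2-associated to $\{Y_1, Y_2\}$ if for all $\mathbf{S} \subseteq \mathbf{V} \setminus \{X, Y_1, Y_2\}$: $X \not\perp\!\!\!\perp_P Y_1 \mid \mathbf{S} \cup \{Y_2\}$, $X \not\perp\!\!\!\perp_P Y_2 \mid \mathbf{S} \cup \{Y_1\}$ and $Y_1 \not\perp\!\!\!\perp_P Y_2 \mid \mathbf{S} \cup \{X\}$. - $X$ is strictly 2-associated to $\{Y_1, Y_2\}$ if $X$ is 2-associated to $\{Y_1,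 Y_2\}$ and $X$ is not 1-associated to $Y_1$ or $Y_2$ (i.e. to neither of them). - For a set $\mathbf{Y}$ with one or two elements, $X -^{s}_{\le 2} \mathbf{Y}$ means that either $\mathbf{Y} = \{Y\}$ and $X$ is 1-associated to $Y$, or $\mathbf{Y} = \{Y_1, Y_2\}$ and $X$ is strictly 2-associated to $\mathbf{Y}$. *)

theory Defs
  imports "HOL-Probability.Probability"
begin

text \<open>
  The variables are the coordinates of the product space \<open>Pi\<^sub>M V N\<close>, where the variable \<open>v\<close> takes
  values in the measurable space \<open>N v\<close>; \<open>P\<close> is the joint distribution. No restriction is placed
  on the value spaces. The pair \<open>(u, v)\<close> in \<open>E\<close> stands for the arrow \<open>u \<rightarrow> v\<close>.
\<close>

locale causal_model = prob_space P
  for V :: "'v set" and E :: "('v \<times> 'v) set"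
    and N :: "'v \<Rightarrow> 'a measure" and P :: "('v \<Rightarrow> 'a) measure" +
  assumes finite_nodes: "finite V"
    and edges_between_nodes: "E \<subseteq> V \<times> V"
    and acyclic_edges: "acyclic E"
    and sets_joint_distribution: "sets P = sets (Pi\<^sub>M V N)"


text \<open>
  The sigma-algebra generated by the variables in \<open>A\<close>; as the conditioning argument of
  \<^const>\<open>real_cond_exp\<close>, only its sets matter, not the (zero) measure it carries.
\<close>

definition var_algebra ::
    "('v \<Rightarrow> 'a measure) \<Rightarrow> ('v \<Rightarrow> 'a) measure \<Rightarrow> 'v set \<Rightarrow> ('v \<Rightarrow> 'a) measure" where
  "var_algebra N P A = vimage_algebra (space P) (\<lambda>\<omega>. restrict \<omega> A) (Pi\<^sub>M A N)"

lemma (in causal_model) subalgebra_var_algebra: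
  assumes "A \<subseteq> V"
  shows "subalgebra P (var_algebra N P A)"
proof -
  have "(\<lambda>\<omega>. restrict \<omega> A) \<in> measurable P (Pi\<^sub>M A N)"
    using measurable_restrict_subset[OF assms]
    by (simp cong: measurable_cong_sets add: sets_joint_distribution)
  then have "sets (var_algebra N P A) \<subseteq> sets P"
    unfolding var_algebra_def by (intro sets_image_in_sets) auto
  then show ?thesis
    by (simp add: subalgebra_def var_algebra_def)
qed

text \<open>
  \<open>P(a \<inter> b | C) = P(a | C) \<cdot> P(b | C)\<close> almost surely for all events \<open>a\<close>, \<open>b\<close> determined by
  \<open>A\<close> and \<open>B\<close> respectively.
\<close>

definition cond_indep ::
    "('v \<Rightarrow> 'a measure) \<Rightarrow> ('v \<Rightarrow> 'a) measure \<Rightarrow> 'v set \<Rightarrow> 'v set \<Rightarrow> 'v set \<Rightarrow> bool" where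
  "cond_indep N P A B C \<longleftrightarrow>
    (\<forall>a \<in> sets (var_algebra N P A). \<forall>b \<in> sets (var_algebra N P B).
      AE \<omega> in P.
        real_cond_exp P (var_algebra N P C) (indicator (a \<inter> b)) \<omega> =
        real_cond_exp P (var_algebra N P C) (indicator a) \<omega> *
        real_cond_exp P (var_algebra N P C) (indicator b) \<omega>)"

abbreviation dependent ::
    "('v \<Rightarrow> 'a measure) \<Rightarrow> ('v \<Rightarrow> 'a) measure \<Rightarrow> 'v \<Rightarrow> 'v \<Rightarrow> 'v set \<Rightarrow> bool" where
  "dependent N P x y S \<equiv> \<not> cond_indep N P {x} {y} S"


definition adjacent :: "('v \<times> 'v) set \<Rightarrow> 'v \<Rightarrow> 'v \<Rightarrow> bool" where
  "adjacent E x y \<longleftrightarrow> (x, y) \<in> E \<or> (y, x) \<in> E"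

definition is_path :: "'v set \<Rightarrow> ('v \<times> 'v) set \<Rightarrow> 'v list \<Rightarrow> bool" where
  "is_path V E p \<longleftrightarrow> p \<noteq> [] \<and> set p \<subseteq> V \<and> distinct p \<and> successively (adjacent E) p"

definition collider :: "('v \<times> 'v) set \<Rightarrow> 'v \<Rightarrow> 'v \<Rightarrow> 'v \<Rightarrow> bool" where
  "collider E x y z \<longleftrightarrow> (x, y) \<in> E \<and> (z, y) \<in> E"

text \<open>
  A path is active given \<open>C\<close> if none of its inner non-colliders is in \<open>C\<close> and each of its
  colliders has a descendant in \<open>C\<close>, every node being a descendant of itself.
\<close>

definition active_path :: "('v \<times> 'v) set \<Rightarrow> 'v set \<Rightarrow> 'v list \<Rightarrow> bool" where
  "active_path E C p \<longleftrightarrow>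
    (\<forall>i. Suc (Suc i) < length p \<longrightarrow>
      (if collider E (p ! i) (p ! Suc i) (p ! Suc (Suc i))
       then \<exists>d \<in> C. (p ! Suc i, d) \<in> E\<^sup>*
       else p ! Suc i \<notin> C))"

definition d_separated ::
    "'v set \<Rightarrow> ('v \<times> 'v) set \<Rightarrow> 'v set \<Rightarrow> 'v set \<Rightarrow> 'v set \<Rightarrow> bool" where
  "d_separated V E A B C \<longleftrightarrow>
    \<not> (\<exists>p. is_path V E p \<and> hd p \<in> A \<and> last p \<in> B \<and> active_path E C p)"

text \<open>As usual, d-separation statements are about pairwise disjoint sets of nodes.\<close>

definition causal_markov ::
    "'v set \<Rightarrow> ('v \<times> 'v) set \<Rightarrow> ('v \<Rightarrow> 'a measure) \<Rightarrow> ('v \<Rightarrow> 'a) measure \<Rightarrow> bool" where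
  "causal_markov V E N P \<longleftrightarrow>
    (\<forall>A B C. A \<subseteq> V \<and> B \<subseteq> V \<and> C \<subseteq> V \<and> A \<inter> B = {} \<and> A \<inter> C = {} \<and> B \<inter> C = {} \<longrightarrow>
      d_separated V E A B C \<longrightarrow> cond_indep N P A B C)"


definition one_associated ::
    "'v set \<Rightarrow> ('v \<Rightarrow> 'a measure) \<Rightarrow> ('v \<Rightarrow> 'a) measure \<Rightarrow> 'v \<Rightarrow> 'v \<Rightarrow> bool" where
  "one_associated V N P x y \<longleftrightarrow>
    x \<in> V \<and> y \<in> V \<and> x \<noteq> y \<and> (\<forall>S \<subseteq> V - {x, y}. dependent N P x y S)"

definition two_associated ::
    "'v set \<Rightarrow> ('v \<Rightarrow> 'a measure) \<Rightarrow> ('v \<Rightarrow> 'a) measure \<Rightarrow> 'v \<Rightarrow> 'v \<Rightarrow> 'v \<Rightarrow> bool" where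
  "two_associated V N P x y1 y2 \<longleftrightarrow>
    x \<in> V \<and> y1 \<in> V \<and> y2 \<in> V \<and> distinct [x, y1, y2] \<and>
    (\<forall>S \<subseteq> V - {x, y1, y2}.
      dependent N P x y1 (S \<union> {y2}) \<and>
      dependent N P x y2 (S \<union> {y1}) \<and>
      dependent N P y1 y2 (S \<union> {x}))"

definition strictly_two_associated ::
    "'v set \<Rightarrow> ('v \<Rightarrow> 'a measure) \<Rightarrow> ('v \<Rightarrow> 'a) measure \<Rightarrow> 'v \<Rightarrow> 'v \<Rightarrow> 'v \<Rightarrow> bool" where
  "strictly_two_associated V N P x y1 y2 \<longleftrightarrow>
    two_associated V N P x y1 y2 \<and>
    \<not> one_associated V N P x y1 \<and> \<not> one_associated V N P x y2"

definition associated_le_two ::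
    "'v set \<Rightarrow> ('v \<Rightarrow> 'a measure) \<Rightarrow> ('v \<Rightarrow> 'a) measure \<Rightarrow> 'v \<Rightarrow> 'v set \<Rightarrow> bool" where
  "associated_le_two V N P x Y \<longleftrightarrow>
    (\<exists>y. Y = {y} \<and> one_associated V N P x y) \<or>
    (\<exists>y1 y2. Y = {y1, y2} \<and> strictly_two_associated V N P x y1 y2)"


text \<open>The premises of the two parts of the orientation rule.\<close>

definition dependent_given_middle ::
    "'v set \<Rightarrow> ('v \<Rightarrow> 'a measure) \<Rightarrow> ('v \<Rightarrow> 'a) measure \<Rightarrow> 'v set \<Rightarrow> 'v \<Rightarrow> 'v set \<Rightarrow> bool" where
  "dependent_given_middle V N P X y Z \<longleftrightarrow>
    (\<forall>x \<in> X. \<forall>z \<in> Z. \<forall>S \<subseteq> V - {x, z}.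
      {y} \<union> (X - {x}) \<union> (Z - {z}) \<subseteq> S \<longrightarrow> dependent N P x z S)"

definition dependent_without_middle ::
    "'v set \<Rightarrow> ('v \<Rightarrow> 'a measure) \<Rightarrow> ('v \<Rightarrow> 'a) measure \<Rightarrow> 'v set \<Rightarrow> 'v \<Rightarrow> 'v set \<Rightarrow> bool" where
  "dependent_without_middle V N P X y Z \<longleftrightarrow>
    (\<forall>x \<in> X. \<forall>z \<in> Z. \<forall>S \<subseteq> V - {x, z}.
      (X - {x}) \<union> (Z - {z}) \<subseteq> S \<and> y \<notin> S \<longrightarrow> dependent N P x z S)"

end

theory Submission
  imports Defs
begin

text \<open>
  Two nodes \<open>a\<close>, \<open>b\<close> of an ancestral set \<open>A\<close> that are not adjacent in its moral graph are
  d-separated by \<open>A - {a, b}\<close>. Under the Markov condition, dependence given \<open>A - {a, b}\<close> therefore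
  makes \<open>a\<close> and \<open>b\<close> adjacent or gives them a common child in \<open>A\<close>. Taking for \<open>A\<close> the ancestors
  of \<open>{y} \<union> X\<close> shows that every \<open>x \<in> X\<close> not adjacent to \<open>y\<close> shares with \<open>y\<close> a child in \<open>X\<close>.

  Let \<open>w\<close> be a node of \<open>X \<union> Z\<close> without proper descendants in \<open>X \<union> Z\<close>, say \<open>w \<in> X\<close>. In (i), every
  \<open>z \<in> Z\<close> has a common child with \<open>w\<close> among the ancestors of \<open>{y} \<union> X \<union> Z\<close>; by the choice of \<open>w\<close>
  it is an ancestor of \<open>y\<close>, so \<open>w\<close> and all of \<open>Z\<close> precede \<open>y\<close>, and the edges at \<open>y\<close> are forced.
  In (ii), if \<open>y\<close> were a collider on every path through it, all of \<open>X \<union> Z\<close> would be parents of \<open>y\<close>,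
  so \<open>y\<close> is not among the ancestors of \<open>X \<union> Z\<close>; a common child of \<open>w\<close> and \<open>z\<close> there contradicts
  the choice of \<open>w\<close>.
\<close>

section \<open>Ancestral sets, moral adjacency and d-separation\<close>

definition ancestors :: "('v \<times> 'v) set \<Rightarrow> 'v set \<Rightarrow> 'v set" where
  "ancestors E T = {v. \<exists>t \<in> T. (v, t) \<in> E\<^sup>*}"

text \<open>Adjacency in the moral graph of the ancestral set of \<open>T\<close>, for
  \<open>a\<close> and \<open>b\<close> in \<open>T\<close>: only the common child has to be
  confined to that set, since \<open>a\<close> and \<open>b\<close> already lie in it.\<close>

definition moral_adjacent :: "('v \<times> 'v) set \<Rightarrow> 'v set \<Rightarrow> 'v \<Rightarrow> 'v \<Rightarrow> bool" where
  "moral_adjacent E T a b \<longleftrightarrow>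
    adjacent E a b \<or> (\<exists>c \<in> ancestors E T. (a, c) \<in> E \<and> (b, c) \<in> E)"

lemma subset_ancestors: "T \<subseteq> ancestors E T"
  by (auto simp: ancestors_def)

lemma ancestors_subset:
  assumes "E \<subseteq> V \<times> V" and "T \<subseteq> V"
  shows "ancestors E T \<subseteq> V"
  using assms by (auto simp: ancestors_def elim: converse_rtranclE)

lemma ancestors_parent: "(u, v) \<in> E \<Longrightarrow> v \<in> ancestors E T \<Longrightarrow> u \<in> ancestors E T"
  by (auto simp: ancestors_def intro: converse_rtrancl_into_rtrancl)

lemma ancestors_closed: "(u, v) \<in> E\<^sup>* \<Longrightarrow> v \<in> ancestors E T \<Longrightarrow> u \<in> ancestors E T"
  by (auto simp: ancestors_def intro: rtrancl_trans)

lemma edge_into_ancestors: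
  assumes "(u, v) \<in> E" and "v \<in> ancestors E T"
  obtains t where "t \<in> T" and "(v, t) \<in> E\<^sup>*" and "(u, t) \<in> E\<^sup>+"
  using assms by (auto simp: ancestors_def intro: rtrancl_into_trancl2)

lemma adjacent_commute: "adjacent E a b \<longleftrightarrow> adjacent E b a"
  by (auto simp: adjacent_def)

lemma moral_adjacent_commute: "moral_adjacent E T a b \<longleftrightarrow> moral_adjacent E T b a"
  by (auto simp: moral_adjacent_def adjacent_commute)

text \<open>Every inner node has a way down into the ancestral set: a collider through its
  descendant in \<open>C\<close>, a non-collider through an edge to a neighbour on the path.
  Induction along the converse of \<open>E\<close> treats children first.\<close>

lemma active_path_subset_ancestors:
  assumes "finite E" and "acyclic E" and "successively (adjacent E) p"
    and act: "active_path E C p" and "C \<subseteq> ancestors E T"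
    and "hd p \<in> ancestors E T" and "last p \<in> ancestors E T"
  shows "set p \<subseteq> ancestors E T"
proof
  have "wf (E\<inverse>)"
    using assms(1,2) by (rule finite_acyclic_wf_converse)
  fix v assume "v \<in> set p"
  with \<open>wf (E\<inverse>)\<close> show "v \<in> ancestors E T"
  proof (induction v rule: wf_induct_rule)
    case (less v)
    obtain i where i: "i < length p" "p ! i = v"
      using less.prems by (metis in_set_conv_nth)
    show ?case
    proof (cases "i = 0 \<or> Suc i = length p")
      case True
      then show ?thesis
      proof (elim disjE)
        assume "i = 0"
        then have "v = hd p"
          using i by (simp add: hd_conv_nth)
        then show ?thesis
          using assms(6) by simp
      next
        assume "Suc i = length p"
        then have "p \<noteq> []" "length p - 1 = i"
          by auto
        then have "v = last p"
          using i(2) by (simp add: last_conv_nth)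
        then show ?thesis
          using assms(7) by simp
      qed
    next
      case False
      then obtain j where j: "i = Suc j" "Suc (Suc j) < length p"
        using i(1) by (cases i) auto
      show ?thesis
      proof (cases "collider E (p ! j) v (p ! Suc (Suc j))")
        case True
        then obtain d where "d \<in> C" "(v, d) \<in> E\<^sup>*"
          using act[unfolded active_path_def, rule_format, OF j(2)] i j by auto
        then show ?thesis
          using \<open>C \<subseteq> ancestors E T\<close> ancestors_closed[of v d] by blast
      next
        case False
        have "adjacent E (p ! j) v" "adjacent E v (p ! Suc (Suc j))"
          using assms(3) i j by (auto simp: successively_conv_nth)
        moreover have "p ! j \<in> set p" "p ! Suc (Suc j) \<in> set p"
          using j by simp_all
        ultimately obtain u where "(v, u) \<in> E" "u \<in> set p"
          using False unfolding collider_def adjacent_def by blast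
        then show ?thesis
          using less.IH[of u] ancestors_parent[of v u] by simp
      qed
    qed
  qed
qed

text \<open>An active path stays in the ancestral set, so all its inner nodes are conditioned on and
  must be colliders. Two consecutive nodes cannot both be colliders, so only an edge or a common
  child could connect \<open>a\<close> and \<open>b\<close>.\<close>

lemma d_separated_ancestors:
  assumes "finite E" and "acyclic E" and "a \<in> T" and "b \<in> T" and "a \<noteq> b"
    and "\<not> moral_adjacent E T a b"
  shows "d_separated V E {a} {b} (ancestors E T - {a, b})"
  unfolding d_separated_def
proof
  let ?C = "ancestors E T - {a, b}"
  assume "\<exists>p. is_path V E p \<and> hd p \<in> {a} \<and> last p \<in> {b} \<and> active_path E ?C p"
  then obtain p where p: "p \<noteq> []" "distinct p" "successively (adjacent E) p"
    and ends: "hd p = a" "last p = b" and act: "active_path E ?C p"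
    by (auto simp: is_path_def)
  have "set p \<subseteq> ancestors E T"
    by (rule active_path_subset_ancestors[OF assms(1,2) p(3) act])
      (use ends assms(3,4) subset_ancestors[of T E] in auto)
  have inner: "collider E (p ! i) (p ! Suc i) (p ! Suc (Suc i))"
    if "Suc (Suc i) < length p" for i
  proof -
    have "p ! Suc i \<noteq> p ! 0" "p ! Suc i \<noteq> p ! (length p - 1)"
      using that p(1,2) by (simp_all add: nth_eq_iff_index_eq)
    moreover have "p ! Suc i \<in> ancestors E T"
      using that \<open>set p \<subseteq> ancestors E T\<close> by (simp add: subset_iff)
    ultimately have "p ! Suc i \<in> ?C"
      using p(1) ends by (auto simp: hd_conv_nth last_conv_nth)
    then show ?thesis
      using act[unfolded active_path_def, rule_format, OF that] by presburger
  qed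
  consider u where "p = [u]" | u v where "p = [u, v]" | u c v where "p = [u, c, v]"
    | u v w x q where "p = u # v # w # x # q"
    using p(1) by (metis neq_Nil_conv)
  then show False
  proof cases
    case 1
    then show False
      using ends assms(5) by simp
  next
    case 2
    then have "adjacent E a b"
      using p(3) ends by simp
    then show False
      using assms(6) by (simp add: moral_adjacent_def)
  next
    case 3
    with ends have "p = [a, c, b]"
      by simp
    then have "(a, c) \<in> E" "(b, c) \<in> E" "c \<in> ancestors E T"
      using inner[of 0] \<open>set p \<subseteq> ancestors E T\<close> by (simp_all add: collider_def)
    then show False
      using assms(6) by (auto simp: moral_adjacent_def)
  next
    \<comment> \<open>Both \<open>v\<close> and \<open>w\<close> would be colliders, so the edge
      between them would point both ways.\<close>
    case 4
    then have "(w, v) \<in> E" "(v, w) \<in> E"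
      using inner[of 0] inner[of 1] by (simp_all add: collider_def)
    then show False
      using \<open>acyclic E\<close> by (meson acyclic_def r_into_trancl trancl_into_trancl)
  qed
qed

text \<open>A common child of \<open>a\<close> and \<open>b\<close> in the ancestral set can lead
  only to \<open>c\<close>, by acyclicity. So \<open>c\<close> lies strictly below \<open>a\<close>
  and \<open>b\<close> and has no child in the set, which leaves only edges into
  \<open>c\<close>.\<close>

lemma moral_adjacent_triple:
  assumes "acyclic E"
    and ab: "moral_adjacent E {a, b, c} a b" and ac: "moral_adjacent E {a, b, c} a c"
    and bc: "moral_adjacent E {a, b, c} b c" and "\<not> adjacent E a b"
  shows "(a, c) \<in> E" and "(b, c) \<in> E"
proof -
  have irr: "(u, u) \<notin> E\<^sup>+" for u
    using \<open>acyclic E\<close> by (simp add: acyclic_def)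
  obtain d where d: "(a, d) \<in> E" "(b, d) \<in> E" "d \<in> ancestors E {a, b, c}"
    using ab assms(5) by (auto simp: moral_adjacent_def)
  have "(d, a) \<notin> E\<^sup>*" "(d, b) \<notin> E\<^sup>*"
    using rtrancl_into_trancl2[OF d(1)] rtrancl_into_trancl2[OF d(2)] irr by blast+
  then have "(d, c) \<in> E\<^sup>*"
    using d(3) by (auto simp: ancestors_def)
  with d have desc: "(a, c) \<in> E\<^sup>+" "(b, c) \<in> E\<^sup>+"
    by (auto intro: rtrancl_into_trancl2)
  have no_child: "e \<notin> ancestors E {a, b, c}" if "(c, e) \<in> E" for e
  proof
    assume "e \<in> ancestors E {a, b, c}"
    with that obtain t where "t \<in> {a, b, c}" "(c, t) \<in> E\<^sup>+"
      by (rule edge_into_ancestors)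
    then have "(c, c) \<in> E\<^sup>+"
      using desc trancl_trans[of c _ E c] by blast
    then show False
      using irr by blast
  qed
  have "(c, u) \<notin> E" if "u \<in> {a, b}" for u
    using no_child[of u] that by (auto simp: ancestors_def)
  then show "(a, c) \<in> E" "(b, c) \<in> E"
    using ac bc no_child by (auto simp: moral_adjacent_def adjacent_def)
qed

section \<open>Graph structure from dependence under the Markov condition\<close>

context causal_model
begin

lemma finite_edges: "finite E"
  using finite_subset[OF edges_between_nodes] finite_nodes by simp

lemma no_cycle: "(u, u) \<notin> E\<^sup>+"
  using acyclic_edges by (simp add: acyclic_def)

lemma dependent_imp_moral_adjacent:
  assumes "causal_markov V E N P" and "T \<subseteq> V" and "a \<in> T" and "b \<in> T" and "a \<noteq> b"
    and "dependent N P a b (ancestors E T - {a, b})"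
  shows "moral_adjacent E T a b"
proof (rule ccontr)
  assume "\<not> moral_adjacent E T a b"
  then have "d_separated V E {a} {b} (ancestors E T - {a, b})"
    by (rule d_separated_ancestors[OF finite_edges acyclic_edges assms(3-5)])
  moreover have "ancestors E T - {a, b} \<subseteq> V"
    using ancestors_subset[OF edges_between_nodes assms(2)] by blast
  moreover have "{a} \<subseteq> V" "{b} \<subseteq> V"
    using assms(2-4) by auto
  ultimately have "cond_indep N P {a} {b} (ancestors E T - {a, b})"
    using assms(1)[unfolded causal_markov_def, rule_format, of "{a}" "{b}"] \<open>a \<noteq> b\<close> by simp
  then show False
    using assms(6) by contradiction
qed

lemma one_associated_imp_adjacent:
  assumes "causal_markov V E N P" and "one_associated V N P a b"
  shows "adjacent E a b"
proof -
  have V: "a \<in> V" "b \<in> V" "a \<noteq> b"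
    using assms(2) by (auto simp: one_associated_def)
  have "ancestors E {a, b} - {a, b} \<subseteq> V - {a, b}"
    using ancestors_subset[OF edges_between_nodes, of "{a, b}"] V by blast
  then have "dependent N P a b (ancestors E {a, b} - {a, b})"
    using assms(2) by (simp add: one_associated_def)
  then have "moral_adjacent E {a, b} a b"
    using V by (intro dependent_imp_moral_adjacent[OF assms(1) _ _ _ V(3)]) simp_all
  \<comment> \<open>A common child leading back to \<open>a\<close> or \<open>b\<close> would close
    a cycle, so moral adjacency here is plain adjacency.\<close>
  moreover have "c \<notin> ancestors E {a, b}" if "(a, c) \<in> E" "(b, c) \<in> E" for c
    using rtrancl_into_trancl2[OF that(1)] rtrancl_into_trancl2[OF that(2)] no_cycle
    by (auto simp: ancestors_def)
  ultimately show ?thesis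
    by (auto simp: moral_adjacent_def)
qed

lemma two_associated_imp_moral_adjacent:
  assumes "causal_markov V E N P" and "two_associated V N P a b c"
  shows "moral_adjacent E {a, b, c} a b" and "moral_adjacent E {a, b, c} a c"
    and "moral_adjacent E {a, b, c} b c"
proof -
  let ?T = "{a, b, c}"
  have V: "?T \<subseteq> V" "a \<noteq> b" "a \<noteq> c" "b \<noteq> c"
    using assms(2) by (auto simp: two_associated_def)
  \<comment> \<open>One \<open>S\<close> serves all three dependences: adding back the third node
    gives the ancestral set without the pair in question.\<close>
  define S where "S = ancestors E ?T - ?T"
  have "S \<subseteq> V - ?T"
    using ancestors_subset[OF edges_between_nodes V(1)] by (auto simp: S_def)
  then have "dependent N P a b (S \<union> {c})" "dependent N P a c (S \<union> {b})"
    "dependent N P b c (S \<union> {a})"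
    using assms(2) unfolding two_associated_def by simp_all
  moreover have "S \<union> {c} = ancestors E ?T - {a, b}" "S \<union> {b} = ancestors E ?T - {a, c}"
    "S \<union> {a} = ancestors E ?T - {b, c}"
    using V subset_ancestors[of ?T E] by (auto simp: S_def)
  ultimately have dep: "dependent N P a b (ancestors E ?T - {a, b})"
    "dependent N P a c (ancestors E ?T - {a, c})" "dependent N P b c (ancestors E ?T - {b, c})"
    by metis+
  note moral = dependent_imp_moral_adjacent[OF assms(1) V(1)]
  show "moral_adjacent E ?T a b" "moral_adjacent E ?T a c" "moral_adjacent E ?T b c"
    by (rule moral[OF _ _ V(2) dep(1)] moral[OF _ _ V(3) dep(2)] moral[OF _ _ V(4) dep(3)]; simp)+
qed

lemma associated_le_two_imp_nonempty: "associated_le_two V N P y X \<Longrightarrow> X \<noteq> {}"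
  by (auto simp: associated_le_two_def)

lemma associated_le_two_not_mem: "associated_le_two V N P y X \<Longrightarrow> y \<notin> X"
  by (auto simp: associated_le_two_def one_associated_def strictly_two_associated_def
      two_associated_def)

lemma associated_le_two_adjacent_or_child:
  assumes markov: "causal_markov V E N P" and "associated_le_two V N P y X" and "x \<in> X"
  shows "adjacent E y x \<or> (\<exists>x' \<in> X. (y, x') \<in> E \<and> (x, x') \<in> E)"
  using assms(2) unfolding associated_le_two_def
proof (elim disjE exE conjE)
  fix x' assume "X = {x'}" "one_associated V N P y x'"
  then show ?thesis
    using one_associated_imp_adjacent[OF markov] \<open>x \<in> X\<close> by auto
next
  fix x1 x2 assume X: "X = {x1, x2}" and "strictly_two_associated V N P y x1 x2"
  then have "two_associated V N P y x1 x2"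
    by (simp add: strictly_two_associated_def)
  note moral = two_associated_imp_moral_adjacent[OF markov this]
  \<comment> \<open>Either element of \<open>X\<close> may be the one not adjacent to
    \<open>y\<close>, so the triple lemma is needed in both orders.\<close>
  have swap: "{y, x1, x2} = {y, x2, x1}"
    by auto
  have "moral_adjacent E {y, x2, x1} y x2" "moral_adjacent E {y, x2, x1} y x1"
    "moral_adjacent E {y, x2, x1} x2 x1"
    using moral by (simp_all only: swap moral_adjacent_commute[of E _ x2 x1])
  note moral' = this
  show ?thesis
    using moral_adjacent_triple[OF acyclic_edges moral]
      moral_adjacent_triple[OF acyclic_edges moral'] \<open>x \<in> X\<close>
    unfolding X by (elim insertE emptyE) blast+
qed

section \<open>Forcing the edges at \<open>y\<close>\<close>

lemma exists_sink:
  assumes "W \<noteq> {}"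
  obtains w where "w \<in> W" and "\<And>v. v \<in> W \<Longrightarrow> (w, v) \<notin> E\<^sup>+"
proof -
  have "wf ((E\<^sup>+)\<inverse>)"
    using wf_trancl[OF finite_acyclic_wf_converse[OF finite_edges acyclic_edges]]
    by (simp add: trancl_converse)
  then show ?thesis
    using assms that by (metis wfE_min' converse_iff)
qed

text \<open>Below \<open>w\<close> only \<open>y\<close> remains as a target for the common
  children. An edge from \<open>y\<close> into \<open>X \<union> Z\<close> would then put a proper
  descendant of \<open>w\<close> there, so every adjacency to \<open>y\<close> is an edge into
  \<open>y\<close> and no child of \<open>y\<close> is available as the alternative.\<close>

lemma parents_if_common_children:
  assumes "w \<in> X" and sink: "\<And>v. v \<in> X \<union> Z \<Longrightarrow> (w, v) \<notin> E\<^sup>+" and "Z \<noteq> {}"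
    and X: "\<And>x. x \<in> X \<Longrightarrow> adjacent E y x \<or> (\<exists>x' \<in> X. (y, x') \<in> E \<and> (x, x') \<in> E)"
    and Z: "\<And>z. z \<in> Z \<Longrightarrow> adjacent E y z \<or> (\<exists>z' \<in> Z. (y, z') \<in> E \<and> (z, z') \<in> E)"
    and common: "\<And>z. z \<in> Z \<Longrightarrow> \<exists>c \<in> ancestors E ({y} \<union> X \<union> Z). (w, c) \<in> E \<and> (z, c) \<in> E"
    and v: "v \<in> X \<union> Z"
  shows "(v, y) \<in> E"
proof -
  have anc: "(w, y) \<in> E\<^sup>+ \<and> (z, y) \<in> E\<^sup>+" if "z \<in> Z" for z
  proof -
    obtain c where c: "c \<in> ancestors E ({y} \<union> X \<union> Z)" "(w, c) \<in> E" "(z, c) \<in> E"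
      using common[OF \<open>z \<in> Z\<close>] by blast
    then obtain t where t: "t \<in> {y} \<union> X \<union> Z" "(c, t) \<in> E\<^sup>*" "(w, t) \<in> E\<^sup>+"
      using edge_into_ancestors by metis
    then have "t = y"
      using sink by blast
    then show ?thesis
      using t rtrancl_into_trancl2[OF c(3) t(2)] by simp
  qed
  then have wy: "(w, y) \<in> E\<^sup>+"
    using \<open>Z \<noteq> {}\<close> by blast
  have "(y, u) \<notin> E" if "u \<in> X \<union> Z" for u
    using sink[OF that] trancl_into_trancl[OF wy, of u] by blast
  then show ?thesis
    using X Z v by (auto simp: adjacent_def)
qed

end

section \<open>Soundness of both parts of the orientation rule\<close>

theorem theorem2:
  fixes V X Z :: "'v set" and E :: "('v \<times> 'v) set" and y :: 'v
    and N :: "'v \<Rightarrow> 'a measure" and P :: "('v \<Rightarrow> 'a) measure"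
  assumes "causal_model V E N P"
    and "causal_markov V E N P"
    and "X \<subseteq> V" and "Z \<subseteq> V" and "X \<inter> Z = {}" and "y \<in> V"
    and "associated_le_two V N P y X"
    and "associated_le_two V N P y Z"
    and "\<forall>x \<in> X. \<forall>z \<in> Z. \<not> adjacent E x z"
  shows "(dependent_given_middle V N P X y Z \<longrightarrow> (\<forall>w \<in> X \<union> Z. (w, y) \<in> E)) \<and>
    (\<not> dependent_given_middle V N P X y Z \<and> dependent_without_middle V N P X y Z \<longrightarrow>
      (\<exists>x \<in> X. \<exists>z \<in> Z. is_path V E [x, y, z] \<and> \<not> collider E x y z))"
proof -
  interpret causal_model V E N P by fact
  note nonempty = associated_le_two_imp_nonempty[OF assms(7)]
    associated_le_two_imp_nonempty[OF assms(8)]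
  have notin: "y \<notin> X \<union> Z"
    using associated_le_two_not_mem[OF assms(7)] associated_le_two_not_mem[OF assms(8)] by blast
  note adjX = associated_le_two_adjacent_or_child[OF assms(2,7)]
  note adjZ = associated_le_two_adjacent_or_child[OF assms(2,8)]
  obtain w where w: "w \<in> X \<union> Z" and sink: "\<And>v. v \<in> X \<union> Z \<Longrightarrow> (w, v) \<notin> E\<^sup>+"
    using exists_sink[of "X \<union> Z"] nonempty by blast
  have common: "\<exists>c \<in> ancestors E T. (x, c) \<in> E \<and> (z, c) \<in> E"
    if "T \<subseteq> V" "X \<union> Z \<subseteq> T" "x \<in> X" "z \<in> Z"
      "dependent N P x z (ancestors E T - {x, z})" for T x z
  proof -
    have "x \<in> T" "z \<in> T" "x \<noteq> z" "\<not> adjacent E x z"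
      using that(2-4) assms(5,9) by auto
    with dependent_imp_moral_adjacent[OF assms(2) that(1) _ _ _ that(5)] show ?thesis
      by (simp add: moral_adjacent_def)
  qed
  have "\<forall>w \<in> X \<union> Z. (w, y) \<in> E" if dep: "dependent_given_middle V N P X y Z"
  proof -
    let ?T = "{y} \<union> X \<union> Z"
    have T: "?T \<subseteq> V" using assms(3,4,6) by blast
    have children: "\<exists>c \<in> ancestors E ?T. (x, c) \<in> E \<and> (z, c) \<in> E" if "x \<in> X" "z \<in> Z" for x z
    proof (rule common[OF T _ that])
      have "ancestors E ?T - {x, z} \<subseteq> V - {x, z}"
        using ancestors_subset[OF edges_between_nodes T] by blast
      moreover have "{y} \<union> (X - {x}) \<union> (Z - {z}) \<subseteq> ancestors E ?T - {x, z}"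
        using subset_ancestors[of ?T E] that notin assms(5) by blast
      ultimately show "dependent N P x z (ancestors E ?T - {x, z})"
        by (rule dep[unfolded dependent_given_middle_def, rule_format, OF that])
    qed blast
    \<comment> \<open>For \<open>w\<close> in \<open>Z\<close> the same lemma applies with
      \<open>X\<close> and \<open>Z\<close> exchanged.\<close>
    have swap: "{y} \<union> Z \<union> X = ?T" "Z \<union> X = X \<union> Z" by auto
    show ?thesis
    proof
      fix v assume v: "v \<in> X \<union> Z"
      from w show "(v, y) \<in> E"
      proof
        assume "w \<in> X"
        show ?thesis
          by (rule parents_if_common_children[OF \<open>w \<in> X\<close> sink nonempty(2) adjX adjZ
                children[OF \<open>w \<in> X\<close>] v])
      next
        assume "w \<in> Z"
        have "\<exists>c \<in> ancestors E ?T. (w, c) \<in> E \<and> (x, c) \<in> E" if "x \<in> X" for x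
          using children[OF that \<open>w \<in> Z\<close>] by blast
        with sink v show ?thesis
          by (intro parents_if_common_children[of w Z X y, unfolded swap, OF \<open>w \<in> Z\<close> _
                nonempty(1) adjZ adjX])
      qed
    qed
  qed
  moreover have "\<exists>x \<in> X. \<exists>z \<in> Z. is_path V E [x, y, z] \<and> \<not> collider E x y z"
    if dep: "dependent_without_middle V N P X y Z"
  proof (rule ccontr)
    assume contr: "\<not> ?thesis"
    have both: "(x, y) \<in> E \<and> (z, y) \<in> E"
      if "x \<in> X" "z \<in> Z" "adjacent E y x" "adjacent E y z" for x z
    proof -
      have "is_path V E [x, y, z]"
        using that assms(3-6) notin by (auto simp: is_path_def adjacent_commute)
      then show ?thesis
        using contr that by (auto simp: collider_def)
    qed
    \<comment> \<open>Each set contains a neighbour of \<open>y\<close>, since the alternative to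
      adjacency also provides a child of \<open>y\<close> in the set. Pairing any neighbour with
      \<open>x0\<close> or \<open>z0\<close> orients its edge into \<open>y\<close>.\<close>
    obtain x0 z0 where "x0 \<in> X" "adjacent E y x0" "z0 \<in> Z" "adjacent E y z0"
      using nonempty adjX adjZ unfolding adjacent_def by blast
    then have "(u, y) \<in> E" if "u \<in> X \<union> Z" "adjacent E y u" for u
      using both that by blast
    then have "(y, u) \<notin> E" if "u \<in> X \<union> Z" for u
      using that no_cycle[of y] trancl_into_trancl[of y u E y] by (auto simp: adjacent_def)
    then have parents: "(u, y) \<in> E" if "u \<in> X \<union> Z" for u
      using that adjX adjZ by (auto simp: adjacent_def)
    let ?T = "X \<union> Z"
    have T: "?T \<subseteq> V" using assms(3,4) by blast
    \<comment> \<open>This makes the ancestral set of \<open>X \<union> Z\<close> an admissible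
      source of conditioning sets, which must avoid \<open>y\<close>.\<close>
    have "y \<notin> ancestors E ?T"
    proof
      assume "y \<in> ancestors E ?T"
      then obtain t where "t \<in> ?T" "(y, t) \<in> E\<^sup>*"
        by (auto simp: ancestors_def)
      then have "(y, y) \<in> E\<^sup>+"
        using rtrancl_into_trancl1[of y t E y] parents by blast
      then show False
        using no_cycle by blast
    qed
    have children: "\<exists>c \<in> ancestors E ?T. (x, c) \<in> E \<and> (z, c) \<in> E" if "x \<in> X" "z \<in> Z" for x z
    proof (rule common[OF T _ that])
      have "ancestors E ?T - {x, z} \<subseteq> V - {x, z}"
        using ancestors_subset[OF edges_between_nodes T] by blast
      moreover have "(X - {x}) \<union> (Z - {z}) \<subseteq> ancestors E ?T - {x, z}"
        using subset_ancestors[of ?T E] that assms(5) by blast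
      ultimately show "dependent N P x z (ancestors E ?T - {x, z})"
        using \<open>y \<notin> ancestors E ?T\<close>
        by (intro dep[unfolded dependent_without_middle_def, rule_format, OF that]) simp_all
    qed blast
    \<comment> \<open>Whichever set contains \<open>w\<close>, it is paired with an arbitrary node
      of the other one.\<close>
    obtain x z where "x \<in> X" "z \<in> Z" "w = x \<or> w = z"
      using w nonempty by blast
    then obtain c where "(w, c) \<in> E" "c \<in> ancestors E ?T"
      using children[of x z] by blast
    then obtain t where "t \<in> ?T" "(w, t) \<in> E\<^sup>+"
      by (rule edge_into_ancestors)
    then show False
      using sink by blast
  qed
  ultimately show ?thesis by blast
qed

end
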